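(* Let $X$ be a large scale finitistic metric space. Then $X$ has strong Property A if and only if $X$ is large scale paracompact.
   Context: Let $X$ be a metric space with metric $d$. $B(x,r)=\{y : d(x,y)<r\}$. A family $\mathcal{U}$ of subsets of $X$ is uniformly bounded if there is $r<\infty$ such that $d(x,y)<r$ whenever $x,y$ lie in the same element of $\mathcal{U}$; the diameter of a set or family is the infimum of such $r$. The Lebesgue number $\operatorname{Leb}(\mathcal{U})$ of a cover is the supremum of all $r\ge 0$ such that every ball $B(x,r)$ is contained in some element of $\mathcal{U}$. A cover $\mathcal{V}$ is a coarsening of $\mathcal{U}$ if each element of $\mathcal{U}$ is contained in an element of $\mathcal{V}$. $X$ is large scale finitistic if for every $r>0$ there is a uniformly bounded cover $\mathcal{U}$ of $X$ with $\operatorname{Leb}(\mathcal{U})\ge r$ and a natural number $n=n(\mathcal{U})>0$ such that each $x\in X$ belongs to at most $n$ elements of $\mathcal{U}$. For a set $V$, $l_1(V)$ is the space of functions $\alpha:V\to\mathbb{R}$ with $\|\alpha\|=\sum_{v\in V}|\alpha(v)|<\infty$; the carrier of $\alpha$ is $\{v:\alpha(v)\ne 0\}$; the open star of $v\in V$ is $\operatorname{st}(v)=\{\alpha\in l_1(V):\alpha(v)\neq 0\}$. A partition of unity on $X$ is a function $f:X\to l_1(V)$ (for some set $V$) with $\|f(x)\|=1$ and $f(x)(v)\ge 0$ for all $x\in X$, $v\in V$. It is simplicial if the carrier of each $f(x)$ is finite. It is barycentric if for each $x$ there is a finite non-empty $C(x)\subset V$ with $f(x)=\chi_{C(x)}/|C(x)|$.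 The cover induced by $f$ is $\{f^{-1}(\operatorname{st}(v))\}_{v\in V}$, and $\operatorname{Leb}(f)$ is the Lebesgue number of this cover. $f$ is cobounded if there is $M>0$ with $\operatorname{diam}(f^{-1}(\operatorname{st}(v)))<M$ for all $v\in V$. $f$ is $(\lambda,C)$-Lipschitz if $\|f(x)-f(y)\|\le\lambda d(x,y)+C$ for all $x,y\in X$. $X$ is large scale paracompact if for each $\mu>0$ there is a simplicial partition of unity $f$ on $X$ that is $(\mu,\mu)$-Lipschitz and whose induced cover is uniformly bounded and is a coarsening of the cover of $X$ by $\frac1\mu$-balls. $X$ has strong Property A if for every $\epsilon>0$ there is an $(\epsilon,\epsilon)$-Lipschitz barycentric partition of unity on $X$ that is cobounded and whose Lebesgue number is at least $\frac1\epsilon$. *)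

theory Defs
  imports "HOL-Analysis.Analysis"
begin

section \<open>The space \<open>l\<^sub>1(V)\<close>\<close>

text \<open>
  A function \<open>V \<rightarrow> \<real>\<close> is represented by a function on the whole type that vanishes outside \<open>V\<close>.
\<close>

definition l1_space :: "'v set \<Rightarrow> ('v \<Rightarrow> real) set" where
  "l1_space V = {\<alpha>. (\<forall>v. v \<notin> V \<longrightarrow> \<alpha> v = 0) \<and> (\<lambda>v. \<bar>\<alpha> v\<bar>) summable_on V}"

definition l1_norm :: "'v set \<Rightarrow> ('v \<Rightarrow> real) \<Rightarrow> real" where
  "l1_norm V \<alpha> = (\<Sum>\<^sub>\<infinity>v\<in>V. \<bar>\<alpha> v\<bar>)"

definition carrier_of :: "'v set \<Rightarrow> ('v \<Rightarrow> real) \<Rightarrow> 'v set" where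
  "carrier_of V \<alpha> = {v \<in> V. \<alpha> v \<noteq> 0}"

definition open_star :: "'v set \<Rightarrow> 'v \<Rightarrow> ('v \<Rightarrow> real) set" where
  "open_star V v = {\<alpha> \<in> l1_space V. \<alpha> v \<noteq> 0}"

definition coarsening :: "'a set set \<Rightarrow> 'a set set \<Rightarrow> bool" where
  "coarsening \<V> \<U> \<longleftrightarrow> (\<forall>U\<in>\<U>. \<exists>V\<in>\<V>. U \<subseteq> V)"

context Metric_space
begin

section \<open>Covers\<close>

definition cover :: "'a set set \<Rightarrow> bool" where
  "cover \<U> \<longleftrightarrow> (\<forall>U\<in>\<U>. U \<subseteq> M) \<and> \<Union>\<U> = M"

definition uniformly_bounded :: "'a set set \<Rightarrow> bool" where
  "uniformly_bounded \<U> \<longleftrightarrow> (\<exists>r. \<forall>U\<in>\<U>. \<forall>x\<in>U. \<forall>y\<in>U. d x y < r)"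

text \<open>Extended reals: an unbounded set has diameter \<open>\<infinity>\<close>, and the empty set has diameter \<open>0\<close>.\<close>

definition diam :: "'a set \<Rightarrow> ereal" where
  "diam A = Inf {ereal r | r. 0 \<le> r \<and> (\<forall>x\<in>A. \<forall>y\<in>A. d x y < r)}"

definition Leb :: "'a set set \<Rightarrow> ereal" where
  "Leb \<U> = Sup {ereal r | r. 0 \<le> r \<and> (\<forall>x\<in>M. \<exists>U\<in>\<U>. mball x r \<subseteq> U)}"

definition large_scale_finitistic :: bool where
  "large_scale_finitistic \<longleftrightarrow>
     (\<forall>r>0. \<exists>\<U>. cover \<U> \<and> uniformly_bounded \<U> \<and> Leb \<U> \<ge> ereal r \<and>
        (\<exists>n::nat. n > 0 \<and> (\<forall>x\<in>M. finite {U \<in> \<U>. x \<in> U} \<and> card {U \<in> \<U>. x \<in> U} \<le> n)))"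

section \<open>Partitions of unity\<close>

definition partition_of_unity :: "'v set \<Rightarrow> ('a \<Rightarrow> 'v \<Rightarrow> real) \<Rightarrow> bool" where
  "partition_of_unity V f \<longleftrightarrow>
     (\<forall>x\<in>M. f x \<in> l1_space V \<and> l1_norm V (f x) = 1 \<and> (\<forall>v\<in>V. f x v \<ge> 0))"

definition simplicial :: "'v set \<Rightarrow> ('a \<Rightarrow> 'v \<Rightarrow> real) \<Rightarrow> bool" where
  "simplicial V f \<longleftrightarrow> (\<forall>x\<in>M. finite (carrier_of V (f x)))"

definition barycentric :: "'v set \<Rightarrow> ('a \<Rightarrow> 'v \<Rightarrow> real) \<Rightarrow> bool" where
  "barycentric V f \<longleftrightarrow>
     (\<forall>x\<in>M. \<exists>C. finite C \<and> C \<noteq> {} \<and> C \<subseteq> V \<and> f x = (\<lambda>v. indicator C v / real (card C)))"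

definition star_preimage :: "'v set \<Rightarrow> ('a \<Rightarrow> 'v \<Rightarrow> real) \<Rightarrow> 'v \<Rightarrow> 'a set" where
  "star_preimage V f v = {x \<in> M. f x \<in> open_star V v}"

definition induced_cover :: "'v set \<Rightarrow> ('a \<Rightarrow> 'v \<Rightarrow> real) \<Rightarrow> 'a set set" where
  "induced_cover V f = star_preimage V f ` V"

definition cobounded :: "'v set \<Rightarrow> ('a \<Rightarrow> 'v \<Rightarrow> real) \<Rightarrow> bool" where
  "cobounded V f \<longleftrightarrow> (\<exists>K>0. \<forall>v\<in>V. diam (star_preimage V f v) < ereal K)"

definition ls_lipschitz :: "real \<Rightarrow> real \<Rightarrow> 'v set \<Rightarrow> ('a \<Rightarrow> 'v \<Rightarrow> real) \<Rightarrow> bool" where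
  "ls_lipschitz L C V f \<longleftrightarrow>
     (\<forall>x\<in>M. \<forall>y\<in>M. l1_norm V (\<lambda>v. f x v - f y v) \<le> L * d x y + C)"

section \<open>Large scale paracompactness and strong Property A\<close>

definition paracompact_partition ::
    "real \<Rightarrow> 'v set \<Rightarrow> ('a \<Rightarrow> 'v \<Rightarrow> real) \<Rightarrow> bool" where
  "paracompact_partition \<mu> V f \<longleftrightarrow>
     partition_of_unity V f \<and> simplicial V f \<and> ls_lipschitz \<mu> \<mu> V f \<and>
     uniformly_bounded (induced_cover V f) \<and>
     coarsening (induced_cover V f) ((\<lambda>x. mball x (1 / \<mu>)) ` M)"

definition property_A_partition ::
    "real \<Rightarrow> 'v set \<Rightarrow> ('a \<Rightarrow> 'v \<Rightarrow> real) \<Rightarrow> bool" where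
  "property_A_partition \<epsilon> V f \<longleftrightarrow>
     partition_of_unity V f \<and> ls_lipschitz \<epsilon> \<epsilon> V f \<and> barycentric V f \<and> cobounded V f \<and>
     Leb (induced_cover V f) \<ge> ereal (1 / \<epsilon>)"

text \<open>
  ``For some set \<open>V\<close>'' would quantify over all types of vertices, which HOL cannot do inside a
  formula. The vertices below are taken from \<^typ>\<open>'a \<times> nat\<close>. This loses nothing: the points of
  the space have countable carriers, so all vertices with a nonempty star preimage can be
  renamed injectively into \<^typ>\<open>'a \<times> nat\<close>, and the others can be dropped; see
  \<open>large_scale_paracompact_any\<close> and \<open>strong_property_A_any\<close>.
\<close>

definition large_scale_paracompact :: bool where
  "large_scale_paracompact \<longleftrightarrow>
     (\<forall>\<mu>>0. \<exists>(V :: ('a \<times> nat) set) f. paracompact_partition \<mu> V f)"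

definition strong_property_A :: bool where
  "strong_property_A \<longleftrightarrow>
     (\<forall>\<epsilon>>0. \<exists>(V :: ('a \<times> nat) set) f. property_A_partition \<epsilon> V f)"

section \<open>Independence of the type of vertices\<close>

lemma relabel:
  fixes V :: "'v set" and f :: "'a \<Rightarrow> 'v \<Rightarrow> real"
  assumes pou: "partition_of_unity V f"
  obtains W :: "'v set" and g :: "'v \<Rightarrow> 'a \<times> nat" and f' where
    "W \<subseteq> V" "inj_on g W"
    "\<And>x v. x \<in> M \<Longrightarrow> v \<in> W \<Longrightarrow> f' x (g v) = f x v"
    "\<And>x u. x \<in> M \<Longrightarrow> u \<notin> g ` W \<Longrightarrow> f' x u = 0"
    "\<And>x v. x \<in> M \<Longrightarrow> v \<notin> W \<Longrightarrow> f x v = 0"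
    "\<And>v. v \<in> W \<Longrightarrow> \<exists>x\<in>M. f x v \<noteq> 0"
proof -
  define S where "S x = carrier_of V (f x)" for x
  have cS: "countable (S x)" if "x \<in> M" for x
  proof -
    have "(\<lambda>v. \<bar>f x v\<bar>) summable_on V"
      using pou that by (simp add: partition_of_unity_def l1_space_def)
    then have "countable {v \<in> V. \<bar>f x v\<bar> \<noteq> 0}"
      by (rule summable_countable_real)
    then show ?thesis by (simp add: S_def carrier_of_def)
  qed
  define W where "W = (\<Union>x\<in>M. S x)"
  define p where "p v = (SOME x. x \<in> M \<and> v \<in> S x)" for v
  have p: "p v \<in> M \<and> v \<in> S (p v)" if "v \<in> W" for v
    unfolding p_def by (rule someI_ex) (use that in \<open>auto simp: W_def\<close>)
  define g where "g v = (p v, to_nat_on (S (p v)) v)" for v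
  have inj: "inj_on g W"
  proof (rule inj_onI)
    fix v w assume "v \<in> W" "w \<in> W" "g v = g w"
    then show "v = w"
      using p[of v] p[of w] cS[of "p v"] by (auto simp: g_def)
  qed
  define f' where "f' x u = (if u \<in> g ` W then f x (inv_into W g u) else 0)" for x u
  show thesis
  proof (rule that[of W g f'])
    show "W \<subseteq> V" by (auto simp: W_def S_def carrier_of_def)
    show "inj_on g W" by (rule inj)
    show "f' x (g v) = f x v" if "v \<in> W" for x v
      using that inj by (simp add: f'_def)
    show "f' x u = 0" if "u \<notin> g ` W" for x u
      using that by (simp add: f'_def)
    show "f x v = 0" if "x \<in> M" "v \<notin> W" for x v
      using that pou
      by (auto simp: W_def S_def carrier_of_def partition_of_unity_def l1_space_def)
    show "\<exists>x\<in>M. f x v \<noteq> 0" if "v \<in> W" for v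
      using p[OF that] by (auto simp: S_def carrier_of_def)
  qed
qed

lemma relabel_partition:
  fixes V :: "'v set" and f :: "'a \<Rightarrow> 'v \<Rightarrow> real"
  assumes pou: "partition_of_unity V f"
  obtains V' :: "('a \<times> nat) set" and f' where
    "partition_of_unity V' f'"
    "simplicial V f \<Longrightarrow> simplicial V' f'"
    "barycentric V f \<Longrightarrow> barycentric V' f'"
    "\<And>L C. ls_lipschitz L C V f \<Longrightarrow> ls_lipschitz L C V' f'"
    "cobounded V f \<Longrightarrow> cobounded V' f'"
    "induced_cover V' f' = induced_cover V f - {{}}"
proof -
  obtain W and g :: "'v \<Rightarrow> 'a \<times> nat" and f' where
    WV: "W \<subseteq> V" and inj: "inj_on g W" and
    f'g: "\<And>x v. x \<in> M \<Longrightarrow> v \<in> W \<Longrightarrow> f' x (g v) = f x v" and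
    f'0: "\<And>x u. x \<in> M \<Longrightarrow> u \<notin> g ` W \<Longrightarrow> f' x u = 0" and
    f0: "\<And>x v. x \<in> M \<Longrightarrow> v \<notin> W \<Longrightarrow> f x v = 0" and
    W: "\<And>v. v \<in> W \<Longrightarrow> \<exists>x\<in>M. f x v \<noteq> 0"
    using relabel[OF pou] by metis
  have l1f: "f x \<in> l1_space V" if "x \<in> M" for x
    using pou that by (simp add: partition_of_unity_def)
  have l1f': "f' x \<in> l1_space (g ` W)" if x: "x \<in> M" for x
  proof -
    have "(\<lambda>v. \<bar>f x v\<bar>) summable_on V"
      using l1f[OF x] by (simp add: l1_space_def)
    then have "(\<lambda>v. \<bar>f x v\<bar>) summable_on W"
      using WV f0[OF x] by (subst summable_on_cong_neutral[where T = V]) auto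
    then have "((\<lambda>u. \<bar>f' x u\<bar>) \<circ> g) summable_on W"
      using f'g[OF x] by (subst summable_on_cong[where g = "\<lambda>v. \<bar>f x v\<bar>"]) auto
    then show ?thesis
      using f'0[OF x] summable_on_reindex[OF inj, of "\<lambda>u. \<bar>f' x u\<bar>"] by (simp add: l1_space_def)
  qed
  have norm_eq: "l1_norm (g ` W) \<beta> = l1_norm V \<alpha>"
    if "\<And>v. v \<in> W \<Longrightarrow> \<beta> (g v) = \<alpha> v" "\<And>v. v \<notin> W \<Longrightarrow> \<alpha> v = 0" for \<alpha> \<beta>
  proof -
    have "l1_norm (g ` W) \<beta> = infsum ((\<lambda>u. \<bar>\<beta> u\<bar>) \<circ> g) W"
      unfolding l1_norm_def by (rule infsum_reindex[OF inj])
    also have "\<dots> = infsum (\<lambda>v. \<bar>\<alpha> v\<bar>) V"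
      using WV that by (intro infsum_cong_neutral) auto
    finally show ?thesis by (simp add: l1_norm_def)
  qed
  have star: "star_preimage (g ` W) f' (g v) = star_preimage V f v" if "v \<in> W" for v
    using that l1f l1f' f'g by (auto simp: star_preimage_def open_star_def)
  show thesis
  proof (rule that[of "g ` W" f'])
    show "partition_of_unity (g ` W) f'"
      unfolding partition_of_unity_def
    proof (intro ballI conjI)
      fix x assume x: "x \<in> M"
      show "f' x \<in> l1_space (g ` W)" by (rule l1f'[OF x])
      show "l1_norm (g ` W) (f' x) = 1"
        using norm_eq[of "f' x" "f x"] f'g[OF x] f0[OF x] pou x
        by (simp add: partition_of_unity_def)
      show "0 \<le> f' x u" if "u \<in> g ` W" for u
        using that f'g[OF x] pou x WV by (auto simp: partition_of_unity_def)
    qed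
    show "simplicial (g ` W) f'" if "simplicial V f"
      unfolding simplicial_def
    proof
      fix x assume x: "x \<in> M"
      have "carrier_of (g ` W) (f' x) \<subseteq> g ` carrier_of V (f x)"
        using f'g[OF x] WV by (auto simp: carrier_of_def)
      moreover have "finite (carrier_of V (f x))"
        using that x by (simp add: simplicial_def)
      ultimately show "finite (carrier_of (g ` W) (f' x))"
        by (meson finite_imageI finite_subset)
    qed
    show "barycentric (g ` W) f'" if bar: "barycentric V f"
      unfolding barycentric_def
    proof
      fix x assume x: "x \<in> M"
      obtain C where C: "finite C" "C \<noteq> {}" "C \<subseteq> V" "f x = (\<lambda>v. indicator C v / real (card C))"
        using bar x unfolding barycentric_def by meson
      have CW: "C \<subseteq> W"
      proof
        fix v assume "v \<in> C"
        then have "f x v \<noteq> 0" using C by auto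
        then show "v \<in> W" using f0[OF x] by blast
      qed
      have "f' x u = indicator (g ` C) u / real (card (g ` C))" for u
      proof (cases "u \<in> g ` W")
        case True
        then obtain v where v: "v \<in> W" "u = g v" by auto
        have "card (g ` C) = card C" using inj CW by (meson card_image inj_on_subset)
        moreover have "g v \<in> g ` C \<longleftrightarrow> v \<in> C" using inj CW v by (meson inj_on_image_mem_iff)
        ultimately show ?thesis using v f'g[OF x] C(4) by (simp add: indicator_def)
      next
        case False
        then show ?thesis using f'0[OF x] CW by (auto simp: indicator_def)
      qed
      then show "\<exists>C. finite C \<and> C \<noteq> {} \<and> C \<subseteq> g ` W \<and>
          f' x = (\<lambda>v. indicator C v / real (card C))"
        using C CW by (intro exI[of _ "g ` C"]) auto
    qed
    show "ls_lipschitz L C (g ` W) f'" if "ls_lipschitz L C V f" for L C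
      unfolding ls_lipschitz_def
    proof (intro ballI)
      fix x y assume x: "x \<in> M" and y: "y \<in> M"
      have "l1_norm (g ` W) (\<lambda>u. f' x u - f' y u) = l1_norm V (\<lambda>v. f x v - f y v)"
        using x y f'g f0 by (intro norm_eq) auto
      then show "l1_norm (g ` W) (\<lambda>u. f' x u - f' y u) \<le> L * d x y + C"
        using that x y by (simp add: ls_lipschitz_def)
    qed
    show "cobounded (g ` W) f'" if "cobounded V f"
    proof -
      obtain K where "K > 0" "\<forall>v\<in>V. diam (star_preimage V f v) < ereal K"
        using \<open>cobounded V f\<close> unfolding cobounded_def by blast
      then have "\<forall>u\<in>g ` W. diam (star_preimage (g ` W) f' u) < ereal K"
        using star WV by (simp add: subset_iff)
      then show ?thesis
        using \<open>K > 0\<close> unfolding cobounded_def by blast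
    qed
    show "induced_cover (g ` W) f' = induced_cover V f - {{}}"
    proof -
      have eq: "induced_cover (g ` W) f' = star_preimage V f ` W"
        using star by (simp add: induced_cover_def image_image)
      have ne: "star_preimage V f v \<noteq> {}" if "v \<in> W" for v
        using W[OF that] l1f by (auto simp: star_preimage_def open_star_def)
      have emp: "star_preimage V f v = {}" if "v \<notin> W" for v
        using f0 that by (auto simp: star_preimage_def open_star_def)
      have "A \<in> star_preimage V f ` V - {{}}" if A: "A \<in> star_preimage V f ` W" for A
      proof -
        obtain v where "v \<in> W" "A = star_preimage V f v" using A by blast
        then show ?thesis using WV ne[of v] by (simp add: subset_iff)
      qed
      moreover have "A \<in> star_preimage V f ` W" if A: "A \<in> star_preimage V f ` V - {{}}" for A
      proof -
        obtain v where v: "A = star_preimage V f v" using A by blast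
        then have "v \<in> W" using A emp[of v] by (cases "v \<in> W") simp_all
        then show ?thesis unfolding v by (rule imageI)
      qed
      ultimately have "star_preimage V f ` W = star_preimage V f ` V - {{}}"
        by (intro set_eqI iffI)
      then show ?thesis unfolding eq by (simp only: induced_cover_def)
    qed
  qed
qed

lemma refined_nonempty:
  assumes "partition_of_unity V f" "x \<in> M" "A \<in> induced_cover V f" "mball x r \<subseteq> A"
  shows "\<exists>A \<in> induced_cover V f - {{}}. mball x r \<subseteq> A"
proof (cases "A = {}")
  case True
  then have e: "mball x r = {}" using assms by auto
  have "\<exists>v\<in>V. f x v \<noteq> 0"
  proof (rule ccontr)
    assume "\<not> ?thesis"
    then have "l1_norm V (f x) = 0" by (auto simp: l1_norm_def intro: infsum_0)
    then show False using assms by (simp add: partition_of_unity_def)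
  qed
  then obtain v where v: "v \<in> V" "f x v \<noteq> 0" by blast
  then have "x \<in> star_preimage V f v"
    using assms by (simp add: star_preimage_def open_star_def partition_of_unity_def)
  then show ?thesis using v e by (auto simp: induced_cover_def)
qed (use assms in auto)

lemma large_scale_paracompact_any:
  assumes "\<And>\<mu>. \<mu> > 0 \<Longrightarrow> \<exists>(V :: 'v set) f. paracompact_partition \<mu> V f"
  shows "large_scale_paracompact"
  unfolding large_scale_paracompact_def
proof (intro allI impI)
  fix \<mu> :: real assume "\<mu> > 0"
  then obtain V :: "'v set" and f where f: "paracompact_partition \<mu> V f"
    using assms by blast
  then have pou: "partition_of_unity V f" by (simp add: paracompact_partition_def)
  obtain V' :: "('a \<times> nat) set" and f' where *:
    "partition_of_unity V' f'" "simplicial V f \<Longrightarrow> simplicial V' f'"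
    "\<And>L C. ls_lipschitz L C V f \<Longrightarrow> ls_lipschitz L C V' f'"
    "induced_cover V' f' = induced_cover V f - {{}}"
    using relabel_partition[OF pou] by metis
  have co: "\<forall>x\<in>M. \<exists>A\<in>induced_cover V f. mball x (1 / \<mu>) \<subseteq> A"
    using f by (simp add: paracompact_partition_def coarsening_def)
  have "\<forall>x\<in>M. \<exists>A\<in>induced_cover V' f'. mball x (1 / \<mu>) \<subseteq> A"
    unfolding *(4) using co refined_nonempty[OF pou] by meson
  then have "coarsening (induced_cover V' f') ((\<lambda>x. mball x (1 / \<mu>)) ` M)"
    by (simp add: coarsening_def)
  moreover have "uniformly_bounded (induced_cover V' f')"
    using f unfolding paracompact_partition_def uniformly_bounded_def *(4) by (meson DiffD1)
  ultimately have "paracompact_partition \<mu> V' f'"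
    using f *(1-3) by (simp add: paracompact_partition_def)
  then show "\<exists>(V :: ('a \<times> nat) set) f. paracompact_partition \<mu> V f" by blast
qed

lemma strong_property_A_any:
  assumes "\<And>\<epsilon>. \<epsilon> > 0 \<Longrightarrow> \<exists>(V :: 'v set) f. property_A_partition \<epsilon> V f"
  shows "strong_property_A"
  unfolding strong_property_A_def
proof (intro allI impI)
  fix \<epsilon> :: real assume "\<epsilon> > 0"
  then obtain V :: "'v set" and f where f: "property_A_partition \<epsilon> V f"
    using assms by blast
  then have pou: "partition_of_unity V f" by (simp add: property_A_partition_def)
  obtain V' :: "('a \<times> nat) set" and f' where *:
    "partition_of_unity V' f'" "barycentric V f \<Longrightarrow> barycentric V' f'"
    "\<And>L C. ls_lipschitz L C V f \<Longrightarrow> ls_lipschitz L C V' f'"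
    "cobounded V f \<Longrightarrow> cobounded V' f'"
    "induced_cover V' f' = induced_cover V f - {{}}"
    using relabel_partition[OF pou] by metis
  have "Leb (induced_cover V f) \<le> Leb (induced_cover V' f')"
    unfolding Leb_def
  proof (rule Sup_subset_mono, rule subsetI)
    fix t assume "t \<in> {ereal r | r. 0 \<le> r \<and> (\<forall>x\<in>M. \<exists>U\<in>induced_cover V f. mball x r \<subseteq> U)}"
    then obtain r where r: "t = ereal r" "0 \<le> r"
      "\<forall>x\<in>M. \<exists>U\<in>induced_cover V f. mball x r \<subseteq> U"
      by auto
    have "\<forall>x\<in>M. \<exists>U\<in>induced_cover V' f'. mball x r \<subseteq> U"
      unfolding *(5) using r(3) refined_nonempty[OF pou] by meson
    then show "t \<in> {ereal r | r. 0 \<le> r \<and> (\<forall>x\<in>M. \<exists>U\<in>induced_cover V' f'. mball x r \<subseteq> U)}"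
      using r(1,2) by blast
  qed
  then have "property_A_partition \<epsilon> V' f'"
    using f * by (auto simp: property_A_partition_def intro: order_trans)
  then show "\<exists>(V :: ('a \<times> nat) set) f. property_A_partition \<epsilon> V f" by blast
qed

end

end

theory Submission
  imports Defs
begin

text \<open>
  Only the passage from large scale paracompactness to strong Property A uses that \<open>X\<close> is large
  scale finitistic. Let \<open>f\<close> be a simplicial partition of unity with small Lipschitz constants and
  uniformly bounded stars. A uniformly bounded cover of finite multiplicity \<open>n\<close> and large Lebesgue
  number coarsens the cover induced by \<open>f\<close>, and pushing \<open>f\<close> forward along the coarsening map gives a
  partition of unity \<open>g\<close> with the same Lipschitz constants whose carriers have at most \<open>n\<close> elements.
  Multiplying by a large \<open>N\<close>, rounding up, and replacing the vertex \<open>u\<close> by \<open>\<lceil>N g(x)(u)\<rceil>\<close> copies of it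
  gives sets \<open>C(x)\<close> with at least \<open>N\<close> elements. Rounding contributes at most \<open>2n\<close> to the size of a
  symmetric difference \<open>C(x) \<triangle> C(y)\<close>, which is negligible compared with \<open>N\<close> because \<open>N\<close> is
  chosen after \<open>n\<close>. Rounding up rather than down keeps the stars, hence the Lebesgue number.
\<close>

section \<open>Finitely supported functions\<close>

lemma l1_norm_finite_support:
  assumes "finite F" "F \<subseteq> V" "\<And>v. v \<in> V - F \<Longrightarrow> \<alpha> v = 0"
  shows "l1_norm V \<alpha> = (\<Sum>v\<in>F. \<bar>\<alpha> v\<bar>)"
proof -
  have "l1_norm V \<alpha> = infsum (\<lambda>v. \<bar>\<alpha> v\<bar>) F"
    unfolding l1_norm_def using assms by (intro infsum_cong_neutral) auto
  then show ?thesis using assms by simp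
qed

lemma l1_space_finite_support:
  assumes "finite F" "F \<subseteq> V" "\<And>v. v \<notin> F \<Longrightarrow> \<alpha> v = 0"
  shows "\<alpha> \<in> l1_space V"
proof -
  have "(\<lambda>v. \<bar>\<alpha> v\<bar>) summable_on F" using assms by simp
  then have "(\<lambda>v. \<bar>\<alpha> v\<bar>) summable_on V"
    using assms by (subst summable_on_cong_neutral[where T = F]) auto
  then show ?thesis using assms by (auto simp: l1_space_def)
qed

text \<open>Replacing \<open>D\<close> by \<open>C\<close> over the fixed denominator
  \<open>card C\<close> costs the size of the symmetric difference divided by \<open>card C\<close>.
  Changing the denominator costs at most as much again, since \<open>card C\<close> and
  \<open>card D\<close> differ by at most that size. Hence the factor 2.\<close>

lemma sum_abs_diff_normalized_indicator:
  assumes "finite C" "finite D" "C \<noteq> {}" "D \<noteq> {}"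
  shows "(\<Sum>v\<in>C \<union> D. \<bar>indicator C v / real (card C) - indicator D v / real (card D)\<bar>)
    \<le> 2 * (\<Sum>v\<in>C \<union> D. \<bar>indicator C v - indicator D v\<bar>) / real (card C)"
proof -
  define c e where "c = real (card C)" and "e = real (card D)"
  define s :: real where "s = (\<Sum>v\<in>C \<union> D. \<bar>indicator C v - indicator D v\<bar>)"
  have pos: "c > 0" "e > 0"
    using assms by (auto simp: c_def e_def card_gt_0_iff)
  have sC: "(\<Sum>v\<in>C \<union> D. indicator C v) = c"
  proof -
    have "(\<Sum>v\<in>C \<union> D. indicator C v) = (\<Sum>v\<in>C. 1::real)"
      using assms by (intro sum.mono_neutral_cong_right) auto
    then show ?thesis by (simp add: c_def)
  qed
  have sD: "(\<Sum>v\<in>C \<union> D. indicator D v) = e"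
  proof -
    have "(\<Sum>v\<in>C \<union> D. indicator D v) = (\<Sum>v\<in>D. 1::real)"
      using assms by (intro sum.mono_neutral_cong_right) auto
    then show ?thesis by (simp add: e_def)
  qed
  have "\<bar>c - e\<bar> = \<bar>\<Sum>v\<in>C \<union> D. indicator C v - indicator D v\<bar>"
    by (simp add: sum_subtractf sC sD)
  also have "\<dots> \<le> s" unfolding s_def by (rule sum_abs)
  finally have ce: "\<bar>c - e\<bar> \<le> s" .
  have "(\<Sum>v\<in>C \<union> D. \<bar>indicator C v / c - indicator D v / e\<bar>)
      \<le> (\<Sum>v\<in>C \<union> D. \<bar>indicator C v - indicator D v\<bar> / c + indicator D v * (\<bar>c - e\<bar> / (c * e)))"
  proof (rule sum_mono)
    fix v
    \<comment> \<open>Insert \<open>indicator D v / c\<close>, separating the change of set from the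
      change of denominator.\<close>
    have "indicator C v / c - indicator D v / e
        = (indicator C v - indicator D v) / c + indicator D v * ((e - c) / (c * e))"
      using pos by (simp add: field_simps)
    also have "\<bar>\<dots>\<bar> \<le> \<bar>(indicator C v - indicator D v) / c\<bar> + \<bar>indicator D v * ((e - c) / (c * e))\<bar>"
      by (rule abs_triangle_ineq)
    also have "\<dots> = \<bar>indicator C v - indicator D v\<bar> / c + indicator D v * (\<bar>c - e\<bar> / (c * e))"
      using pos by (simp add: abs_mult abs_minus_commute)
    finally show "\<bar>indicator C v / c - indicator D v / e\<bar>
        \<le> \<bar>indicator C v - indicator D v\<bar> / c + indicator D v * (\<bar>c - e\<bar> / (c * e))" .
  qed
  also have "\<dots> = s / c + e * (\<bar>c - e\<bar> / (c * e))"
    by (simp only: sum.distrib sum_divide_distrib[symmetric] sum_distrib_right[symmetric] sD s_def)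
  also have "\<dots> = (s + \<bar>c - e\<bar>) / c"
    using pos by (simp add: field_simps)
  also have "\<dots> \<le> 2 * s / c"
    using pos ce by (intro divide_right_mono) auto
  finally show ?thesis by (simp add: c_def e_def s_def)
qed

section \<open>Multisets as subsets of the product with the natural numbers\<close>

text \<open>Each fibre is an initial segment, so the fibres of two such sets over \<open>u\<close>
  are nested. This makes the size of the symmetric difference equal to the l1 distance of the
  multiplicities, and \<open>(u, 0)\<close> is present as soon as \<open>u\<close> has any
  copy.\<close>

definition copies :: "('u \<Rightarrow> nat) \<Rightarrow> ('u \<times> nat) set" where
  "copies k = {(u, i). i < k u}"

lemma copies_eq_Sigma:
  assumes "\<And>u. u \<notin> T \<Longrightarrow> k u = 0"
  shows "copies k = Sigma T (\<lambda>u. {..<k u})"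
proof (rule set_eqI)
  fix p :: "'a \<times> nat"
  show "p \<in> copies k \<longleftrightarrow> p \<in> Sigma T (\<lambda>u. {..<k u})"
    using assms[of "fst p"] by (cases "fst p \<in> T") (auto simp: copies_def)
qed

lemma finite_copies:
  assumes "finite T" "\<And>u. u \<notin> T \<Longrightarrow> k u = 0"
  shows "finite (copies k)"
  using assms by (simp add: copies_eq_Sigma[where T = T])

lemma card_copies:
  assumes "finite T" "\<And>u. u \<notin> T \<Longrightarrow> k u = 0"
  shows "card (copies k) = (\<Sum>u\<in>T. k u)"
  using assms by (simp add: copies_eq_Sigma[where T = T])

lemma sum_abs_diff_indicator_lessThan:
  "(\<Sum>i<max a b. \<bar>indicator {..<a} i - indicator {..<b} i\<bar>) = \<bar>real a - real b\<bar>"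
proof (cases "a \<le> b")
  case True
  have "(\<Sum>i<b. \<bar>indicator {..<a} i - indicator {..<b} i\<bar>) = (\<Sum>i\<in>{a..<b}. 1::real)"
    by (rule sum.mono_neutral_cong_right) (auto simp: indicator_def)
  then show ?thesis using True by (simp add: max_def)
next
  case False
  have "(\<Sum>i<a. \<bar>indicator {..<a} i - indicator {..<b} i\<bar>) = (\<Sum>i\<in>{b..<a}. 1::real)"
    using False by (intro sum.mono_neutral_cong_right) (auto simp: indicator_def)
  then show ?thesis using False by (simp add: max_def)
qed

lemma sum_abs_diff_indicator_copies:
  assumes T: "finite T" and k: "\<And>u. u \<notin> T \<Longrightarrow> k u = 0" and l: "\<And>u. u \<notin> T \<Longrightarrow> l u = 0"
  shows "(\<Sum>p\<in>copies k \<union> copies l. \<bar>indicator (copies k) p - indicator (copies l) p\<bar>)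
    = (\<Sum>u\<in>T. \<bar>real (k u) - real (l u)\<bar>)"
proof -
  \<comment> \<open>The union is again a set of copies, hence a \<open>Sigma\<close> set, over which
    the sum splits into fibres.\<close>
  have "copies k \<union> copies l = copies (\<lambda>u. max (k u) (l u))"
    by (auto simp: copies_def less_max_iff_disj)
  also have "\<dots> = Sigma T (\<lambda>u. {..<max (k u) (l u)})"
    by (rule copies_eq_Sigma) (simp add: k l)
  finally have "copies k \<union> copies l = Sigma T (\<lambda>u. {..<max (k u) (l u)})" .
  then have "(\<Sum>p\<in>copies k \<union> copies l. \<bar>indicator (copies k) p - indicator (copies l) p\<bar>)
      = (\<Sum>u\<in>T. \<Sum>i<max (k u) (l u).
          \<bar>indicator (copies k) (u, i) - indicator (copies l) (u, i)\<bar> :: real)"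
    by (subst sum.Sigma) (simp_all add: T case_prod_unfold)
  also have "\<dots> = (\<Sum>u\<in>T. \<Sum>i<max (k u) (l u).
      \<bar>indicator {..<k u} i - indicator {..<l u} i\<bar>)"
    by (simp add: copies_def indicator_def)
  finally show ?thesis by (simp only: sum_abs_diff_indicator_lessThan)
qed

text \<open>Rounding up adds a number in [0, 1) on each side, and two such errors differ by less
  than 1.\<close>

lemma abs_diff_nat_ceiling_le:
  fixes a b :: real
  assumes "0 \<le> a" "0 \<le> b"
  shows "\<bar>real (nat \<lceil>a\<rceil>) - real (nat \<lceil>b\<rceil>)\<bar> \<le> \<bar>a - b\<bar> + 1"
proof -
  have "real (nat \<lceil>a\<rceil>) = of_int \<lceil>a\<rceil>" "real (nat \<lceil>b\<rceil>) = of_int \<lceil>b\<rceil>"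
    using assms by (simp_all add: of_nat_nat ceiling_le_zero)
  then show ?thesis by linarith
qed

context Metric_space
begin

section \<open>Lebesgue numbers\<close>

text \<open>The supremum need not be attained, but strictness supplies an admissible
  \<open>s > r\<close>, and balls grow with the radius.\<close>

lemma less_LebD:
  assumes "ereal r < Leb \<U>" "x \<in> M"
  shows "\<exists>U\<in>\<U>. mball x r \<subseteq> U"
proof -
  obtain s where "r < s" "\<forall>x\<in>M. \<exists>U\<in>\<U>. mball x s \<subseteq> U"
    using assms(1) unfolding Leb_def less_Sup_iff by auto
  then show ?thesis
    using assms(2) mball_subset_concentric[of r s x] by (meson less_imp_le order_trans)
qed

lemma le_LebI:
  assumes "0 \<le> r" "\<And>x. x \<in> M \<Longrightarrow> \<exists>U\<in>\<U>. mball x r \<subseteq> U"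
  shows "ereal r \<le> Leb \<U>"
  unfolding Leb_def using assms by (intro Sup_upper) auto

section \<open>Simplicial and barycentric partitions of unity\<close>

lemma star_preimage_eq:
  assumes "partition_of_unity V f"
  shows "star_preimage V f v = {x \<in> M. f x v \<noteq> 0}"
  using assms by (auto simp: star_preimage_def open_star_def partition_of_unity_def)

lemma partition_of_unity_outside:
  assumes "partition_of_unity V f" "x \<in> M" "v \<notin> V"
  shows "f x v = 0"
  using assms by (simp add: partition_of_unity_def l1_space_def)

lemma partition_of_unity_nonneg:
  assumes "partition_of_unity V f" "x \<in> M"
  shows "0 \<le> f x v"
  using assms partition_of_unity_outside[OF assms, of v]
  by (cases "v \<in> V") (auto simp: partition_of_unity_def)

lemma partition_of_unity_sum:
  assumes pou: "partition_of_unity V f" and x: "x \<in> M"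
    and F: "finite F" "carrier_of V (f x) \<subseteq> F" "F \<subseteq> V"
  shows "sum (f x) F = 1"
proof -
  have "l1_norm V (f x) = (\<Sum>v\<in>F. \<bar>f x v\<bar>)"
    using F by (intro l1_norm_finite_support) (auto simp: carrier_of_def)
  also have "\<dots> = sum (f x) F"
    using partition_of_unity_nonneg[OF pou x] by simp
  finally show ?thesis using pou x by (simp add: partition_of_unity_def)
qed

lemma partition_of_unityI:
  assumes "\<And>x. x \<in> M \<Longrightarrow> finite (F x)" "\<And>x. x \<in> M \<Longrightarrow> F x \<subseteq> V"
    and "\<And>x v. x \<in> M \<Longrightarrow> v \<notin> F x \<Longrightarrow> f x v = 0"
    and nonneg: "\<And>x v. x \<in> M \<Longrightarrow> v \<in> F x \<Longrightarrow> 0 \<le> f x v"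
    and "\<And>x. x \<in> M \<Longrightarrow> sum (f x) (F x) = 1"
  shows "partition_of_unity V f"
  unfolding partition_of_unity_def
proof (intro ballI conjI)
  fix x assume x: "x \<in> M"
  show "f x \<in> l1_space V"
    using assms x by (intro l1_space_finite_support[where F = "F x"]) auto
  have "l1_norm V (f x) = (\<Sum>v\<in>F x. \<bar>f x v\<bar>)"
    using assms x by (intro l1_norm_finite_support) auto
  then show "l1_norm V (f x) = 1"
    using assms x by simp
  show "0 \<le> f x v" for v
    using assms(3)[OF x, of v] nonneg[OF x, of v] by (cases "v \<in> F x") auto
qed

lemma barycentric_imp_simplicial:
  assumes "barycentric V f"
  shows "simplicial V f"
  unfolding simplicial_def
proof
  fix x assume "x \<in> M"
  then obtain C where C: "finite C" "f x = (\<lambda>v. indicator C v / real (card C))"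
    using assms unfolding barycentric_def by metis
  then have "carrier_of V (f x) \<subseteq> C"
    by (auto simp: carrier_of_def indicator_def)
  then show "finite (carrier_of V (f x))"
    using C finite_subset by blast
qed

lemma partition_of_unity_normalized_indicator:
  assumes "\<And>x. x \<in> M \<Longrightarrow> finite (C x) \<and> C x \<noteq> {} \<and> C x \<subseteq> V"
  shows "partition_of_unity V (\<lambda>x v. indicator (C x) v / real (card (C x)))"
proof (rule partition_of_unityI[where F = C])
  fix x assume x: "x \<in> M"
  show "(\<Sum>v\<in>C x. indicator (C x) v / real (card (C x))) = 1"
    using assms[OF x] by (simp add: sum_divide_distrib[symmetric])
qed (use assms in auto)

section \<open>Pushing a partition of unity forward\<close>

text \<open>The linear extension of the vertex map \<open>\<phi>\<close>, applied to
  \<open>f x\<close>. A fibre of \<open>\<phi>\<close> may be infinite, where \<open>sum\<close>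
  would return 0; restricting to the carrier keeps the sum finite for simplicial
  \<open>f\<close>.\<close>

definition pushforward ::
    "('v \<Rightarrow> 'w) \<Rightarrow> 'v set \<Rightarrow> ('a \<Rightarrow> 'v \<Rightarrow> real) \<Rightarrow> 'a \<Rightarrow> 'w \<Rightarrow> real" where
  "pushforward \<phi> V f x w = (\<Sum>v | v \<in> carrier_of V (f x) \<and> \<phi> v = w. f x v)"

text \<open>Allows the values at two points to be computed over one common finite set.\<close>

lemma pushforward_superset:
  assumes "finite F" "carrier_of V (f x) \<subseteq> F" "F \<subseteq> V"
  shows "pushforward \<phi> V f x w = (\<Sum>v | v \<in> F \<and> \<phi> v = w. f x v)"
  unfolding pushforward_def
  using assms by (intro sum.mono_neutral_left) (auto simp: carrier_of_def)

text \<open>Nonnegative terms cannot cancel. Hence the star preimage of \<open>w\<close> is the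
  union of those of the vertices above \<open>w\<close>.\<close>

lemma pushforward_nonzero_iff:
  assumes "partition_of_unity V f" "simplicial V f" "x \<in> M"
  shows "pushforward \<phi> V f x w \<noteq> 0 \<longleftrightarrow> (\<exists>v\<in>V. \<phi> v = w \<and> f x v \<noteq> 0)"
proof -
  have "finite {v. v \<in> carrier_of V (f x) \<and> \<phi> v = w}"
    using assms(2,3) by (simp add: simplicial_def)
  then show ?thesis
    unfolding pushforward_def
    using partition_of_unity_nonneg[OF assms(1,3)]
    by (subst sum_nonneg_eq_0_iff) (auto simp: carrier_of_def)
qed

lemma partition_of_unity_pushforward:
  assumes pou: "partition_of_unity V f" and simp: "simplicial V f" and "\<phi> ` V \<subseteq> W"
  shows "partition_of_unity W (pushforward \<phi> V f)"
proof (rule partition_of_unityI[where F = "\<lambda>x. \<phi> ` carrier_of V (f x)"])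
  fix x assume x: "x \<in> M"
  have fin: "finite (carrier_of V (f x))" using simp x by (simp add: simplicial_def)
  then show "finite (\<phi> ` carrier_of V (f x))" by simp
  show "\<phi> ` carrier_of V (f x) \<subseteq> W"
    using assms by (auto simp: carrier_of_def)
  show "pushforward \<phi> V f x w = 0" if "w \<notin> \<phi> ` carrier_of V (f x)" for w
    using that pushforward_nonzero_iff[OF pou simp x, of \<phi> w] by (auto simp: carrier_of_def)
  show "0 \<le> pushforward \<phi> V f x w" for w
    unfolding pushforward_def using partition_of_unity_nonneg[OF pou x] by (simp add: sum_nonneg)
  have "sum (pushforward \<phi> V f x) (\<phi> ` carrier_of V (f x)) = sum (f x) (carrier_of V (f x))"
    unfolding pushforward_def using fin by (simp add: sum.image_gen[symmetric])
  also have "\<dots> = 1"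
    using fin by (intro partition_of_unity_sum[OF pou x]) (auto simp: carrier_of_def)
  finally show "sum (pushforward \<phi> V f x) (\<phi> ` carrier_of V (f x)) = 1" .
qed

text \<open>By the triangle inequality on each fibre of \<open>\<phi>\<close>, the linear extension
  does not increase the l1 norm.\<close>

lemma ls_lipschitz_pushforward:
  assumes pou: "partition_of_unity V f" and simp: "simplicial V f" and W: "\<phi> ` V \<subseteq> W"
    and lip: "ls_lipschitz L K V f"
  shows "ls_lipschitz L K W (pushforward \<phi> V f)"
  unfolding ls_lipschitz_def
proof (intro ballI)
  fix x y assume x: "x \<in> M" and y: "y \<in> M"
  define g where "g = pushforward \<phi> V f"
  define F where "F = carrier_of V (f x) \<union> carrier_of V (f y)"
  have F: "finite F" "F \<subseteq> V" "carrier_of V (f x) \<subseteq> F" "carrier_of V (f y) \<subseteq> F"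
    using simp x y by (auto simp: F_def simplicial_def carrier_of_def)
  have g: "g z w = (\<Sum>v | v \<in> F \<and> \<phi> v = w. f z v)" if "z \<in> {x, y}" for z w
    using that F unfolding g_def by (intro pushforward_superset) auto
  have g0: "g x w = 0 \<and> g y w = 0" if "w \<notin> \<phi> ` F" for w
  proof -
    have "{v. v \<in> F \<and> \<phi> v = w} = {}" using that by blast
    then show ?thesis using g[of x w] g[of y w] by (simp only: insert_iff simp_thms sum.empty)
  qed
  have "l1_norm W (\<lambda>w. g x w - g y w) = (\<Sum>w\<in>\<phi> ` F. \<bar>g x w - g y w\<bar>)"
  proof (rule l1_norm_finite_support)
    show "\<phi> ` F \<subseteq> W" using F(2) W by blast
  qed (use F g0 in auto)
  also have "\<dots> \<le> (\<Sum>w\<in>\<phi> ` F. \<Sum>v | v \<in> F \<and> \<phi> v = w. \<bar>f x v - f y v\<bar>)"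
    by (intro sum_mono) (simp add: g sum_subtractf[symmetric] sum_abs)
  also have "\<dots> = (\<Sum>v\<in>F. \<bar>f x v - f y v\<bar>)"
    using F by (simp add: sum.image_gen[symmetric])
  also have "\<dots> = l1_norm V (\<lambda>v. f x v - f y v)"
    using F(1,2) by (intro l1_norm_finite_support[symmetric]) (auto simp: F_def carrier_of_def)
  also have "\<dots> \<le> L * d x y + K"
    using lip x y by (simp add: ls_lipschitz_def)
  finally show "l1_norm W (\<lambda>w. pushforward \<phi> V f x w - pushforward \<phi> V f y w) \<le> L * d x y + K"
    by (simp add: g_def)
qed

section \<open>Rounding to a barycentric partition of unity\<close>

text \<open>Normalization doubles both constants and rounding contributes \<open>\<delta>\<close>.
  Of the two claims on stars, the equality for copy 0 preserves the Lebesgue number and the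
  inclusion for all copies preserves boundedness.\<close>

lemma barycentric_approximation:
  fixes V :: "'v set"
  assumes pou: "partition_of_unity V f" and lip: "ls_lipschitz L K V f" and "\<delta> > 0"
    and bound: "\<And>x. x \<in> M \<Longrightarrow> finite (carrier_of V (f x)) \<and> card (carrier_of V (f x)) \<le> n"
  obtains h :: "'a \<Rightarrow> 'v \<times> nat \<Rightarrow> real" where
    "partition_of_unity (V \<times> UNIV) h" "barycentric (V \<times> UNIV) h"
    "ls_lipschitz (2 * L) (2 * K + \<delta>) (V \<times> UNIV) h"
    "\<And>v. star_preimage (V \<times> UNIV) h (v, 0) = star_preimage V f v"
    "\<And>v i. star_preimage (V \<times> UNIV) h (v, i) \<subseteq> star_preimage V f v"
proof -
  \<comment> \<open>At most \<open>2 * n\<close> vertices carry a rounding error of at most 1 each;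
    normalization doubles the total and divides it by \<open>N\<close>.\<close>
  obtain N :: nat where N: "N > 0" "4 * real n / real N \<le> \<delta>"
  proof -
    obtain N :: nat where *: "4 * real n / \<delta> < real N" using reals_Archimedean2 by blast
    then have "N > 0" using \<open>\<delta> > 0\<close> by (cases N) (auto simp: divide_less_0_iff)
    then show thesis using * \<open>\<delta> > 0\<close> by (intro that[of N]) (auto simp: field_simps)
  qed
  define k where "k x v = nat \<lceil>real N * f x v\<rceil>" for x v
  define C where "C x = copies (k x)" for x
  define h where "h x p = indicator (C x) p / real (card (C x))" for x p
  have nonneg: "0 \<le> real N * f x v" if "x \<in> M" for x v
    using partition_of_unity_nonneg[OF pou that] by simp
  have k0: "k x v = 0" if "x \<in> M" "v \<notin> carrier_of V (f x)" for x v
    using that partition_of_unity_outside[OF pou, of x v] by (auto simp: k_def carrier_of_def)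
  have k_pos: "0 < k x v \<longleftrightarrow> f x v \<noteq> 0" if "x \<in> M" for x v
  proof -
    have "0 < k x v \<longleftrightarrow> 0 < real N * f x v" by (simp add: k_def)
    also have "\<dots> \<longleftrightarrow> 0 < f x v" using N(1) by (simp add: zero_less_mult_iff)
    also have "\<dots> \<longleftrightarrow> f x v \<noteq> 0" using partition_of_unity_nonneg[OF pou that, of v] by auto
    finally show ?thesis .
  qed
  \<comment> \<open>Rounding up only enlarges the total mass \<open>N\<close>. This makes
    \<open>C x\<close> nonempty and bounds the later denominators from below, uniformly in
    \<open>x\<close>.\<close>
  have card_C: "real N \<le> real (card (C x))" if x: "x \<in> M" for x
  proof -
    have "real N = (\<Sum>v\<in>carrier_of V (f x). real N * f x v)"
      using partition_of_unity_sum[OF pou x, of "carrier_of V (f x)"] bound[OF x]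
      by (simp add: sum_distrib_left[symmetric] carrier_of_def)
    also have "\<dots> \<le> (\<Sum>v\<in>carrier_of V (f x). real (k x v))"
      by (intro sum_mono) (simp add: k_def real_nat_ceiling_ge)
    also have "\<dots> = real (card (C x))"
      unfolding C_def using card_copies[of "carrier_of V (f x)" "k x"] bound[OF x] k0[OF x] by simp
    finally show ?thesis .
  qed
  have C: "finite (C x) \<and> C x \<noteq> {} \<and> C x \<subseteq> V \<times> UNIV" if x: "x \<in> M" for x
  proof (intro conjI)
    show "finite (C x)"
      unfolding C_def using bound[OF x] k0[OF x] by (intro finite_copies) auto
    show "C x \<noteq> {}" using card_C[OF x] N by auto
    show "C x \<subseteq> V \<times> UNIV"
    proof
      fix p assume "p \<in> C x"
      then have "k x (fst p) \<noteq> 0" by (auto simp: C_def copies_def)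
      then have "fst p \<in> carrier_of V (f x)" using k0[OF x, of "fst p"] by argo
      then show "p \<in> V \<times> UNIV" by (auto simp: carrier_of_def mem_Times_iff)
    qed
  qed
  have pou_h: "partition_of_unity (V \<times> UNIV) h"
    using partition_of_unity_normalized_indicator[of C, OF C] by (simp add: h_def[abs_def])
  have star_h: "star_preimage (V \<times> UNIV) h (v, i) = {x \<in> M. i < k x v}" for v i
  proof -
    have "h x (v, i) \<noteq> 0 \<longleftrightarrow> i < k x v" if x: "x \<in> M" for x
    proof -
      have "h x (v, i) \<noteq> 0 \<longleftrightarrow> (v, i) \<in> C x" using C[OF x] by (simp add: h_def indicator_def)
      then show ?thesis by (simp add: C_def copies_def)
    qed
    then show ?thesis unfolding star_preimage_eq[OF pou_h] by blast
  qed
  show thesis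
  proof (rule that[of h])
    show "partition_of_unity (V \<times> UNIV) h" by (rule pou_h)
    show "barycentric (V \<times> UNIV) h"
      unfolding barycentric_def
    proof
      fix x assume "x \<in> M"
      then show "\<exists>C. finite C \<and> C \<noteq> {} \<and> C \<subseteq> V \<times> UNIV \<and>
          h x = (\<lambda>v. indicator C v / real (card C))"
        using C by (intro exI[of _ "C x"]) (auto simp: h_def)
    qed
    show "star_preimage (V \<times> UNIV) h (v, 0) = star_preimage V f v" for v
      unfolding star_h star_preimage_eq[OF pou] using k_pos by auto
    show "star_preimage (V \<times> UNIV) h (v, i) \<subseteq> star_preimage V f v" for v i
      unfolding star_h star_preimage_eq[OF pou] using k_pos gr_implies_not0 by fastforce
    show "ls_lipschitz (2 * L) (2 * K + \<delta>) (V \<times> UNIV) h"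
      unfolding ls_lipschitz_def
    proof (intro ballI)
      fix x y assume x: "x \<in> M" and y: "y \<in> M"
      define T where "T = carrier_of V (f x) \<union> carrier_of V (f y)"
      have T: "finite T" "T \<subseteq> V" using bound[OF x] bound[OF y] by (auto simp: T_def carrier_of_def)
      have "card T \<le> 2 * n"
        using card_Un_le[of "carrier_of V (f x)" "carrier_of V (f y)"] bound[OF x] bound[OF y]
        unfolding T_def by linarith
      then have cT: "real (card T) \<le> 2 * real n" by simp
      have kT: "k x v = 0" "k y v = 0" if "v \<notin> T" for v
        using that k0[OF x] k0[OF y] by (auto simp: T_def)
      define s where "s = (\<Sum>p\<in>C x \<union> C y. \<bar>indicator (C x) p - indicator (C y) p\<bar> :: real)"
      have "s = (\<Sum>v\<in>T. \<bar>real (k x v) - real (k y v)\<bar>)"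
        unfolding s_def C_def using T kT by (intro sum_abs_diff_indicator_copies) auto
      also have "\<dots> \<le> (\<Sum>v\<in>T. \<bar>real N * f x v - real N * f y v\<bar> + 1)"
        unfolding k_def by (intro sum_mono abs_diff_nat_ceiling_le nonneg x y)
      also have "\<dots> = real N * (\<Sum>v\<in>T. \<bar>f x v - f y v\<bar>) + real (card T)"
        by (simp add: sum.distrib sum_distrib_left abs_mult right_diff_distrib[symmetric])
      also have "(\<Sum>v\<in>T. \<bar>f x v - f y v\<bar>) = l1_norm V (\<lambda>v. f x v - f y v)"
        using T by (intro l1_norm_finite_support[symmetric]) (auto simp: T_def carrier_of_def)
      also have "real N * \<dots> + real (card T) \<le> real N * (L * d x y + K) + 2 * real n"
        using lip x y cT by (intro add_mono mult_left_mono) (auto simp: ls_lipschitz_def)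
      finally have s: "s \<le> real N * (L * d x y + K) + 2 * real n" .
      have "l1_norm (V \<times> UNIV) (\<lambda>p. h x p - h y p) = (\<Sum>p\<in>C x \<union> C y. \<bar>h x p - h y p\<bar>)"
        using C[OF x] C[OF y] by (intro l1_norm_finite_support) (auto simp: h_def)
      also have "\<dots> \<le> 2 * s / real (card (C x))"
        unfolding h_def s_def using C[OF x] C[OF y] by (intro sum_abs_diff_normalized_indicator) auto
      \<comment> \<open>From here on the denominator no longer depends on \<open>x\<close>, so the
        factor \<open>N\<close> in the bound for \<open>s\<close> cancels.\<close>
      also have "\<dots> \<le> 2 * s / real N"
        using card_C[OF x] N by (intro divide_left_mono) (auto simp: s_def intro!: sum_nonneg)
      also have "\<dots> \<le> 2 * (real N * (L * d x y + K) + 2 * real n) / real N"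
        using s by (intro divide_right_mono) auto
      also have "\<dots> = 2 * (L * d x y + K) + 4 * real n / real N"
        using N by (simp add: field_simps)
      also have "\<dots> \<le> 2 * L * d x y + (2 * K + \<delta>)"
        using N by simp
      finally show "l1_norm (V \<times> UNIV) (\<lambda>p. h x p - h y p) \<le> 2 * L * d x y + (2 * K + \<delta>)" .
    qed
  qed
qed

section \<open>The two implications\<close>

text \<open>The conditions translate one by one: barycentric implies simplicial, cobounded means
  that the induced cover is uniformly bounded, and a Lebesgue number above \<open>1 / \<mu>\<close>
  gives the coarsening.\<close>

lemma strong_property_A_imp_large_scale_paracompact:
  assumes strong_property_A
  shows large_scale_paracompact
  unfolding large_scale_paracompact_def
proof (intro allI impI)
  fix \<mu> :: real assume \<mu>: "\<mu> > 0"
  \<comment> \<open>Halving \<open>\<mu>\<close> makes the Lebesgue number strictly larger than \<open>1 / \<mu>\<close>; the supremum in its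
    definition need not be attained.\<close>
  then obtain V :: "('a \<times> nat) set" and f where f: "property_A_partition (\<mu> / 2) V f"
    using assms unfolding strong_property_A_def by (meson half_gt_zero)
  have lip: "ls_lipschitz \<mu> \<mu> V f"
    unfolding ls_lipschitz_def
  proof (intro ballI)
    fix x y assume "x \<in> M" "y \<in> M"
    then have "l1_norm V (\<lambda>v. f x v - f y v) \<le> \<mu> / 2 * d x y + \<mu> / 2"
      using f by (simp add: property_A_partition_def ls_lipschitz_def)
    also have "\<dots> \<le> \<mu> * d x y + \<mu>"
      using \<mu> by (intro add_mono mult_right_mono) auto
    finally show "l1_norm V (\<lambda>v. f x v - f y v) \<le> \<mu> * d x y + \<mu>" .
  qed
  have bdd: "uniformly_bounded (induced_cover V f)"
  proof -
    obtain K where K: "\<forall>v\<in>V. diam (star_preimage V f v) < ereal K"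
      using f unfolding property_A_partition_def cobounded_def by blast
    have "d x y < K" if v: "v \<in> V" and xy: "x \<in> star_preimage V f v" "y \<in> star_preimage V f v" for v x y
    proof -
      have "diam (star_preimage V f v) < ereal K" using K v by blast
      then obtain r where "r < K" "\<forall>x\<in>star_preimage V f v. \<forall>y\<in>star_preimage V f v. d x y < r"
        unfolding diam_def Inf_less_iff by auto
      then show ?thesis using xy by fastforce
    qed
    then show ?thesis unfolding uniformly_bounded_def induced_cover_def by blast
  qed
  have "ereal (1 / \<mu>) < ereal (1 / (\<mu> / 2))"
    using \<mu> by (simp add: field_simps)
  also have "\<dots> \<le> Leb (induced_cover V f)"
    using f by (simp add: property_A_partition_def)
  finally have "coarsening (induced_cover V f) ((\<lambda>x. mball x (1 / \<mu>)) ` M)"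
    using less_LebD by (auto simp: coarsening_def)
  then have "paracompact_partition \<mu> V f"
    using f lip bdd barycentric_imp_simplicial
    by (auto simp: paracompact_partition_def property_A_partition_def)
  then show "\<exists>(V :: ('a \<times> nat) set) f. paracompact_partition \<mu> V f" by blast
qed

lemma large_scale_paracompact_imp_strong_property_A:
  assumes large_scale_finitistic large_scale_paracompact
  shows strong_property_A
\<comment> \<open>Vertices are pairs of a member of the finite multiplicity cover and a copy
  index.\<close>
proof (rule strong_property_A_any[where 'v = "'a set \<times> nat"])
  fix \<epsilon> :: real assume \<epsilon>: "\<epsilon> > 0"
  \<comment> \<open>The pushforward keeps the constant \<open>\<epsilon> / 4\<close>; rounding with
    \<open>\<delta> = \<epsilon> / 2\<close> turns it into
    \<open>2 * (\<epsilon> / 4) + \<epsilon> / 2 = \<epsilon>\<close>.\<close>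
  then obtain V :: "('a \<times> nat) set" and f where f: "paracompact_partition (\<epsilon> / 4) V f"
    using assms(2) unfolding large_scale_paracompact_def
    by (metis zero_less_divide_iff zero_less_numeral)
  have pou: "partition_of_unity V f" and simp: "simplicial V f"
    and lip: "ls_lipschitz (\<epsilon> / 4) (\<epsilon> / 4) V f"
    using f by (auto simp: paracompact_partition_def)
  obtain R where R: "R > 0"
    "\<And>v x y. v \<in> V \<Longrightarrow> x \<in> star_preimage V f v \<Longrightarrow> y \<in> star_preimage V f v \<Longrightarrow> d x y < R"
  proof -
    obtain r where "\<And>v x y. v \<in> V \<Longrightarrow> x \<in> star_preimage V f v \<Longrightarrow> y \<in> star_preimage V f v
        \<Longrightarrow> d x y < r"
      using f unfolding paracompact_partition_def uniformly_bounded_def induced_cover_def by blast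
    then show thesis by (intro that[of "max r 1"]) (fastforce simp: less_max_iff_disj)+
  qed
  \<comment> \<open>Asking for \<open>R + 1\<close> makes the Lebesgue number strictly larger than
    \<open>R\<close>, as \<open>less_LebD\<close> requires.\<close>
  obtain \<U> n r where U: "Leb \<U> \<ge> ereal (R + 1)" "\<And>A x y. A \<in> \<U> \<Longrightarrow> x \<in> A \<Longrightarrow> y \<in> A \<Longrightarrow> d x y < r"
    "\<And>x. x \<in> M \<Longrightarrow> finite {A \<in> \<U>. x \<in> A} \<and> card {A \<in> \<U>. x \<in> A} \<le> n"
  proof -
    have "R + 1 > 0" using R by simp
    then obtain \<U> and n :: nat where *: "uniformly_bounded \<U>" "Leb \<U> \<ge> ereal (R + 1)"
      "\<forall>x\<in>M. finite {A \<in> \<U>. x \<in> A} \<and> card {A \<in> \<U>. x \<in> A} \<le> n"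
      using assms(1) unfolding large_scale_finitistic_def by blast
    obtain r where "\<forall>A\<in>\<U>. \<forall>x\<in>A. \<forall>y\<in>A. d x y < r"
      using *(1) unfolding uniformly_bounded_def by blast
    then show thesis using * by (intro that[of \<U> r n]) auto
  qed
  \<comment> \<open>A nonempty star lies in the ball of radius \<open>R\<close> about any of its
    points, hence in a member of \<open>\<U>\<close>. For an empty star any value will do, as such a
    vertex lies in no carrier.\<close>
  have "\<exists>A. star_preimage V f v \<noteq> {} \<longrightarrow> A \<in> \<U> \<and> star_preimage V f v \<subseteq> A" if v: "v \<in> V" for v
  proof (cases "star_preimage V f v = {}")
    case False
    then obtain x where x: "x \<in> star_preimage V f v" by blast
    then have xM: "x \<in> M" by (simp add: star_preimage_def)
    have "ereal R < Leb \<U>" using U(1) by (rule less_le_trans[rotated]) simp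
    then obtain A where "A \<in> \<U>" "mball x R \<subseteq> A" using less_LebD xM by blast
    moreover have "star_preimage V f v \<subseteq> mball x R"
      using R(2)[OF v x] xM by (auto simp: star_preimage_def)
    ultimately show ?thesis by blast
  qed simp
  then obtain \<phi> where \<phi>: "\<And>v. v \<in> V \<Longrightarrow> star_preimage V f v \<noteq> {} \<Longrightarrow>
      \<phi> v \<in> \<U> \<and> star_preimage V f v \<subseteq> \<phi> v"
    by metis
  define W where "W = \<phi> ` V"
  define g where "g = pushforward \<phi> V f"
  have W: "\<phi> ` V \<subseteq> W" by (simp add: W_def)
  have pou_g: "partition_of_unity W g"
    unfolding g_def by (rule partition_of_unity_pushforward[OF pou simp W])
  have lip_g: "ls_lipschitz (\<epsilon> / 4) (\<epsilon> / 4) W g"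
    unfolding g_def by (rule ls_lipschitz_pushforward[OF pou simp W lip])
  have g_nz: "g x A \<noteq> 0 \<longleftrightarrow> (\<exists>v\<in>V. \<phi> v = A \<and> f x v \<noteq> 0)" if "x \<in> M" for x A
    unfolding g_def by (rule pushforward_nonzero_iff[OF pou simp that])
  have g_mem: "A \<in> \<U> \<and> x \<in> A" if x: "x \<in> M" and nz: "g x A \<noteq> 0" for x A
  proof -
    obtain v where v: "v \<in> V" "\<phi> v = A" "f x v \<noteq> 0" using g_nz[OF x] nz by blast
    then have "x \<in> star_preimage V f v" using x by (simp add: star_preimage_eq[OF pou])
    then show ?thesis using \<phi>[OF v(1)] v(2) by blast
  qed
  \<comment> \<open>The carrier of \<open>g x\<close> consists of members of \<open>\<U>\<close>
    containing \<open>x\<close>, so the multiplicity of \<open>\<U>\<close> bounds it.\<close>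
  have card_g: "finite (carrier_of W (g x)) \<and> card (carrier_of W (g x)) \<le> n" if x: "x \<in> M" for x
  proof -
    have "carrier_of W (g x) \<subseteq> {A \<in> \<U>. x \<in> A}"
      using g_mem[OF x] by (auto simp: carrier_of_def)
    then show ?thesis
      using U(3)[OF x] by (meson card_mono finite_subset le_trans)
  qed
  have "\<epsilon> / 2 > 0" using \<epsilon> by simp
  then obtain h :: "'a \<Rightarrow> 'a set \<times> nat \<Rightarrow> real" where
    h: "partition_of_unity (W \<times> UNIV) h" "barycentric (W \<times> UNIV) h"
      "ls_lipschitz (2 * (\<epsilon> / 4)) (2 * (\<epsilon> / 4) + \<epsilon> / 2) (W \<times> UNIV) h"
    and star_h: "\<And>A. star_preimage (W \<times> UNIV) h (A, 0) = star_preimage W g A"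
      "\<And>A i. star_preimage (W \<times> UNIV) h (A, i) \<subseteq> star_preimage W g A"
    using barycentric_approximation[OF pou_g lip_g _ card_g] by metis
  have lip_h: "ls_lipschitz \<epsilon> \<epsilon> (W \<times> UNIV) h"
    unfolding ls_lipschitz_def
  proof (intro ballI)
    fix x y assume "x \<in> M" "y \<in> M"
    then have "l1_norm (W \<times> UNIV) (\<lambda>v. h x v - h y v) \<le> 2 * (\<epsilon> / 4) * d x y + (2 * (\<epsilon> / 4) + \<epsilon> / 2)"
      using h(3) unfolding ls_lipschitz_def by blast
    also have "\<dots> \<le> \<epsilon> * d x y + \<epsilon>"
      using \<epsilon> by (intro add_mono mult_right_mono) auto
    finally show "l1_norm (W \<times> UNIV) (\<lambda>v. h x v - h y v) \<le> \<epsilon> * d x y + \<epsilon>" .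
  qed
  have cobounded_h: "cobounded (W \<times> UNIV) h"
    unfolding cobounded_def
  \<comment> \<open>\<open>max r 0\<close> keeps the bounds nonnegative, as \<open>diam\<close>
    demands; the gap between adding 1/2 and adding 1 makes the inequality strict.\<close>
  proof (intro exI[of _ "max r 0 + 1"] conjI ballI)
    fix p assume "p \<in> W \<times> (UNIV :: nat set)"
    have "d x y < max r 0 + 1/2"
      if xy: "x \<in> star_preimage (W \<times> UNIV) h p" "y \<in> star_preimage (W \<times> UNIV) h p" for x y
    proof -
      have "{x, y} \<subseteq> star_preimage W g (fst p)"
        using xy star_h(2)[of "fst p" "snd p"] by auto
      then have "d x y < r"
        using g_mem U(2)[of "fst p" x y] by (auto simp: star_preimage_eq[OF pou_g])
      then show ?thesis by simp
    qed
    then have "diam (star_preimage (W \<times> UNIV) h p) \<le> ereal (max r 0 + 1/2)"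
      unfolding diam_def by (intro Inf_lower) force
    then show "diam (star_preimage (W \<times> UNIV) h p) < ereal (max r 0 + 1)"
      by (rule le_less_trans) simp
  qed simp
  have "ereal (1 / \<epsilon>) \<le> Leb (induced_cover (W \<times> UNIV) h)"
  proof (rule le_LebI)
    show "0 \<le> 1 / \<epsilon>" using \<epsilon> by simp
    fix x assume x: "x \<in> M"
    \<comment> \<open>A ball inside the star of \<open>v\<close> stays inside the star of
      \<open>\<phi> v\<close> for \<open>g\<close>, which is the star of copy 0 of
      \<open>\<phi> v\<close> for \<open>h\<close>.\<close>
    obtain v where v: "v \<in> V" "mball x (1 / (\<epsilon> / 4)) \<subseteq> star_preimage V f v"
      using f x unfolding paracompact_partition_def coarsening_def induced_cover_def by blast
    have "mball x (1 / \<epsilon>) \<subseteq> mball x (1 / (\<epsilon> / 4))"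
      using \<epsilon> by (intro mball_subset_concentric) (simp add: field_simps)
    also note v(2)
    also have "star_preimage V f v \<subseteq> star_preimage W g (\<phi> v)"
      using g_nz v(1) by (auto simp: star_preimage_eq[OF pou] star_preimage_eq[OF pou_g])
    also have "\<dots> = star_preimage (W \<times> UNIV) h (\<phi> v, 0)"
      by (simp add: star_h)
    finally show "\<exists>U\<in>induced_cover (W \<times> UNIV) h. mball x (1 / \<epsilon>) \<subseteq> U"
      unfolding induced_cover_def W_def using v(1) by blast
  qed
  then show "\<exists>(V :: ('a set \<times> nat) set) f. property_A_partition \<epsilon> V f"
    using h lip_h cobounded_h unfolding property_A_partition_def by blast
qed

end

theorem theorem5p13:
  fixes M :: "'a set" and d :: "'a \<Rightarrow> 'a \<Rightarrow> real"
  assumes "Metric_space M d"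
    and "Metric_space.large_scale_finitistic M d"
  shows "Metric_space.strong_property_A M d \<longleftrightarrow> Metric_space.large_scale_paracompact M d"
  using Metric_space.strong_property_A_imp_large_scale_paracompact[OF assms(1)]
    Metric_space.large_scale_paracompact_imp_strong_property_A[OF assms] by blast

end
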